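(* Let $(\pi_X,\mu_X)$ and $(\pi_Y,\mu_Y)$ be $\square$-graphons on measurable spaces $(X,\mathcal A)$ and $(Y,\mathcal B)$, respectively. (1) Let $f\colon X\to Y$ be an isomorphism between the measurable spaces $(X,\mathcal A)$ and $(Y,\mathcal B)$ (a bijection such that $f$ and $f^{-1}$ are measurable) such that $f_*\pi_X=\pi_Y$ and $f^{\otimes2}_*\mu_X=\mu_Y$. Then the Markov kernel $\kappa_f$ is an isomorphism from $(\pi_X,\mu_X)$ to $(\pi_Y,\mu_Y)$ in the category of all $\square$-graphons. (2) If all singleton subsets of $X$ and $Y$ are measurable, then every isomorphism from $(\pi_X,\mu_X)$ to $(\pi_Y,\mu_Y)$ in the category of all $\square$-graphons is of this form, i.e. equals $\kappa_f$ for some isomorphism $f\colon X\to Y$ of measurable spaces with $f_*\pi_X=\pi_Y$ and $f^{\otimes2}_*\mu_X=\mu_Y$.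
   Context: A $\square$-graphon on a measurable space $(X,\mathcal A)$ is a pair $(\pi,\mu)$, where $\pi$ is a probability measure on $(X,\mathcal A)$ and $\mu$ is a finite measure on $(X,\mathcal A)^2=(X^2,\mathcal A^2)$, with $\mathcal A^2$ the product $\sigma$-algebra. A Markov kernel from $(X,\mathcal A)$ to $(Y,\mathcal B)$ is a map $\kappa\colon X\times\mathcal B\to[0,1]$ such that $\kappa(x,\cdot)$ is a probability measure on $(Y,\mathcal B)$ for every $x\in X$ and $\kappa(\cdot,B)$ is measurable for every $B\in\mathcal B$. The Markov kernel $\kappa^{\otimes 2}$ from $(X,\mathcal A)^2$ to $(Y,\mathcal B)^2$ is given by $\kappa^{\otimes 2}((x_1,x_2),\widetilde B)=(\kappa(x_1,\cdot)\times\kappa(x_2,\cdot))(\widetilde B)$ (product measure). For a measure $\pi$ on $(X,\mathcal A)$, the pushforward along $\kappa$ is the measure $\kappa_*\pi(B)=\int_X\kappa(x,B)\,d\pi(x)$, $B\in\mathcal B$. For a measurable map $f\colon X\to Y$, $f_*$ denotes the classical pushforward of measures, $f^{\otimes2}(x_1,x_2)=(f(x_1),f(x_2))$, and $\kappa_f$ is the Markov kernel given by $\kappa_f(x,B)=1$ if $f(x)\in B$ and $\kappa_f(x,B)=0$ otherwise. The category of all $\square$-graphons: a morphism from a $\square$-graphon $(\pi_X,\mu_X)$ on $(X,\mathcal A)$ to a $\square$-graphon $(\pi_Y,\mu_Y)$ on $(Y,\mathcal B)$ is a Markov kernel $\kappa$ from $(X,\mathcal A)$ to $(Y,\mathcal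 B)$ with $\kappa_*\pi_X=\pi_Y$ and $\kappa^{\otimes2}_*\mu_X=\mu_Y$; composition is $(\kappa'\circ\kappa)(x,C)=\int_Y\kappa'(y,C)\,\kappa(x,dy)$; the identity morphism of $(\pi_X,\mu_X)$ is $\kappa_{\mathrm{id}_X}$. An isomorphism is a morphism having a two-sided inverse morphism. *)

theory Defs
  imports "HOL-Probability.Probability"
begin

text \<open>
  A measurable space is represented by a value \<open>X :: 'a measure\<close> of which only \<open>space X\<close> and
  \<open>sets X\<close> are used; the measures living on it are separate values with the same \<open>sets\<close>.
\<close>

definition box_graphon :: "'a measure \<Rightarrow> 'a measure \<times> ('a \<times> 'a) measure \<Rightarrow> bool" where
  "box_graphon X = (\<lambda>(\<pi>, \<mu>).
     sets \<pi> = sets X \<and> prob_space \<pi> \<and> sets \<mu> = sets (X \<Otimes>\<^sub>M X) \<and> finite_measure \<mu>)"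

text \<open>
  A Markov kernel is represented by the map sending a point \<open>x\<close> to the measure \<open>\<kappa>(x, \<cdot>)\<close>. Kernels are
  extensional (\<open>undefined\<close> off \<open>space X\<close>), so that HOL equality is equality of kernels. The lemma
  \<open>markov_kernels_iff\<close> below spells out membership pointwise.
\<close>

definition markov_kernels :: "'a measure \<Rightarrow> 'b measure \<Rightarrow> ('a \<Rightarrow> 'b measure) set" where
  "markov_kernels X Y = (X \<rightarrow>\<^sub>M prob_algebra Y) \<inter> extensional (space X)"

definition kernel_square :: "'a measure \<Rightarrow> ('a \<Rightarrow> 'b measure) \<Rightarrow> 'a \<times> 'a \<Rightarrow> ('b \<times> 'b) measure" where
  "kernel_square X \<kappa> = (\<lambda>x\<in>space X \<times> space X. \<kappa> (fst x) \<Otimes>\<^sub>M \<kappa> (snd x))"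

definition kernel_push :: "('a \<Rightarrow> 'b measure) \<Rightarrow> 'a measure \<Rightarrow> 'b measure" where
  "kernel_push \<kappa> \<nu> = Giry_Monad.bind \<nu> \<kappa>"

definition kernel_comp ::
    "'a measure \<Rightarrow> ('b \<Rightarrow> 'c measure) \<Rightarrow> ('a \<Rightarrow> 'b measure) \<Rightarrow> 'a \<Rightarrow> 'c measure" where
  "kernel_comp X \<kappa>' \<kappa> = (\<lambda>x\<in>space X. Giry_Monad.bind (\<kappa> x) \<kappa>')"

definition kernel_of :: "'a measure \<Rightarrow> 'b measure \<Rightarrow> ('a \<Rightarrow> 'b) \<Rightarrow> 'a \<Rightarrow> 'b measure" where
  "kernel_of X Y f = (\<lambda>x\<in>space X. return Y (f x))"

lemma markov_kernels_iff:
  "\<kappa> \<in> markov_kernels X Y \<longleftrightarrow>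
     \<kappa> \<in> extensional (space X) \<and>
     (\<forall>x\<in>space X. sets (\<kappa> x) = sets Y \<and> prob_space (\<kappa> x)) \<and>
     (\<forall>B\<in>sets Y. (\<lambda>x. emeasure (\<kappa> x) B) \<in> borel_measurable X)"
proof
  assume "\<kappa> \<in> markov_kernels X Y"
  then have k: "\<kappa> \<in> X \<rightarrow>\<^sub>M prob_algebra Y" and e: "\<kappa> \<in> extensional (space X)"
    by (auto simp: markov_kernels_def)
  have "sets (\<kappa> x) = sets Y \<and> prob_space (\<kappa> x)" if "x \<in> space X" for x
    using measurable_space[OF k that] by (simp add: space_prob_algebra)
  moreover have "(\<lambda>x. emeasure (\<kappa> x) B) \<in> borel_measurable X" if "B \<in> sets Y" for B
    using measurable_emeasure_kernel[OF measurable_prob_algebraD[OF k] that] .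
  ultimately show "\<kappa> \<in> extensional (space X) \<and>
     (\<forall>x\<in>space X. sets (\<kappa> x) = sets Y \<and> prob_space (\<kappa> x)) \<and>
     (\<forall>B\<in>sets Y. (\<lambda>x. emeasure (\<kappa> x) B) \<in> borel_measurable X)"
    using e by blast
next
  assume *: "\<kappa> \<in> extensional (space X) \<and>
     (\<forall>x\<in>space X. sets (\<kappa> x) = sets Y \<and> prob_space (\<kappa> x)) \<and>
     (\<forall>B\<in>sets Y. (\<lambda>x. emeasure (\<kappa> x) B) \<in> borel_measurable X)"
  have "\<kappa> \<in> X \<rightarrow>\<^sub>M subprob_algebra Y"
    using * by (intro measurable_subprob_algebra) (auto intro: prob_space_imp_subprob_space)
  then have "\<kappa> \<in> X \<rightarrow>\<^sub>M prob_algebra Y"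
    using * by (auto simp: prob_algebra_def intro!: measurable_restrict_space2)
  then show "\<kappa> \<in> markov_kernels X Y"
    using * by (simp add: markov_kernels_def)
qed

text \<open>The monadic bind is the integral of the kernel:\<close>

lemma emeasure_kernel_push:
  assumes "\<kappa> \<in> markov_kernels X Y" "sets \<nu> = sets X" "space X \<noteq> {}" "B \<in> sets Y"
  shows "emeasure (kernel_push \<kappa> \<nu>) B = (\<integral>\<^sup>+ x. emeasure (\<kappa> x) B \<partial>\<nu>)"
proof -
  have "\<kappa> \<in> \<nu> \<rightarrow>\<^sub>M subprob_algebra Y"
    using assms(1,2) by (auto simp: markov_kernels_def measurable_prob_algebraD cong: measurable_cong_sets)
  then show ?thesis
    unfolding kernel_push_def
    using assms(3,4) sets_eq_imp_space_eq[OF assms(2)] by (intro emeasure_bind) auto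
qed

lemma emeasure_kernel_comp:
  assumes "\<kappa> \<in> markov_kernels X Y" "\<kappa>' \<in> markov_kernels Y Z" "x \<in> space X" "C \<in> sets Z"
  shows "emeasure (kernel_comp X \<kappa>' \<kappa> x) C = (\<integral>\<^sup>+ y. emeasure (\<kappa>' y) C \<partial>\<kappa> x)"
proof -
  have s: "sets (\<kappa> x) = sets Y" and p: "prob_space (\<kappa> x)"
    using assms(1,3) by (auto simp: markov_kernels_iff)
  have "space Y \<noteq> {}"
    using prob_space.not_empty[OF p] sets_eq_imp_space_eq[OF s] by simp
  then show ?thesis
    using emeasure_kernel_push[OF assms(2) s _ assms(4)] assms(3)
    by (simp add: kernel_comp_def kernel_push_def)
qed

lemma emeasure_kernel_of:
  assumes "x \<in> space X" "B \<in> sets Y"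
  shows "emeasure (kernel_of X Y f x) B = (if f x \<in> B then 1 else 0)"
  using assms by (simp add: kernel_of_def indicator_def)

lemma kernel_square_markov:
  assumes "\<kappa> \<in> markov_kernels X Y"
  shows "kernel_square X \<kappa> \<in> markov_kernels (X \<Otimes>\<^sub>M X) (Y \<Otimes>\<^sub>M Y)"
proof -
  have [measurable]: "\<kappa> \<in> X \<rightarrow>\<^sub>M prob_algebra Y"
    using assms by (simp add: markov_kernels_def)
  have "(\<lambda>x. \<kappa> (fst x) \<Otimes>\<^sub>M \<kappa> (snd x)) \<in> X \<Otimes>\<^sub>M X \<rightarrow>\<^sub>M prob_algebra (Y \<Otimes>\<^sub>M Y)"
    by measurable
  moreover have "kernel_square X \<kappa> \<in> X \<Otimes>\<^sub>M X \<rightarrow>\<^sub>M prob_algebra (Y \<Otimes>\<^sub>M Y) \<longleftrightarrow>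
      (\<lambda>x. \<kappa> (fst x) \<Otimes>\<^sub>M \<kappa> (snd x)) \<in> X \<Otimes>\<^sub>M X \<rightarrow>\<^sub>M prob_algebra (Y \<Otimes>\<^sub>M Y)"
    by (intro measurable_cong) (simp add: kernel_square_def space_pair_measure)
  ultimately show ?thesis
    by (simp add: markov_kernels_def kernel_square_def space_pair_measure)
qed

text \<open>The category of all box-graphons; identities are \<open>kernel_of X X (\<lambda>x. x)\<close>.\<close>

definition graphon_hom ::
    "'a measure \<Rightarrow> 'a measure \<times> ('a \<times> 'a) measure \<Rightarrow>
     'b measure \<Rightarrow> 'b measure \<times> ('b \<times> 'b) measure \<Rightarrow> ('a \<Rightarrow> 'b measure) set" where
  "graphon_hom X G Y H =
     {\<kappa> \<in> markov_kernels X Y.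
        kernel_push \<kappa> (fst G) = fst H \<and> kernel_push (kernel_square X \<kappa>) (snd G) = snd H}"

definition graphon_iso ::
    "'a measure \<Rightarrow> 'a measure \<times> ('a \<times> 'a) measure \<Rightarrow>
     'b measure \<Rightarrow> 'b measure \<times> ('b \<times> 'b) measure \<Rightarrow> ('a \<Rightarrow> 'b measure) set" where
  "graphon_iso X G Y H =
     {\<kappa> \<in> graphon_hom X G Y H.
        \<exists>\<kappa>' \<in> graphon_hom Y H X G.
          kernel_comp X \<kappa>' \<kappa> = kernel_of X X (\<lambda>x. x) \<and>
          kernel_comp Y \<kappa> \<kappa>' = kernel_of Y Y (\<lambda>y. y)}"

definition measurable_iso :: "'a measure \<Rightarrow> 'b measure \<Rightarrow> ('a \<Rightarrow> 'b) set" where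
  "measurable_iso X Y =
     {f \<in> X \<rightarrow>\<^sub>M Y. bij_betw f (space X) (space Y) \<and> inv_into (space X) f \<in> Y \<rightarrow>\<^sub>M X}"

end

theory Submission
  imports Defs
begin

text \<open>
  Everything rests on the dictionary between maps and Dirac-valued kernels: under
  \<^term>\<open>kernel_of\<close>, composition of maps becomes composition of kernels, the product map
  \<^term>\<open>map_prod f f\<close> becomes the kernel square, and the kernel pushforward becomes the classical
  one (lemmas \<open>kernel_comp_kernel_of\<close>, \<open>kernel_square_kernel_of\<close>, \<open>kernel_push_kernel_of\<close>).
  Part (1) follows by applying this to \<open>f\<close> and to its inverse.

  For part (2), let \<open>\<kappa>\<close> and \<open>\<kappa>'\<close> be mutually inverse kernels. Since \<open>\<integral> \<kappa>'(y, {x}) \<kappa>(x, dy) = 1\<close> and the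
  integrand is at most 1, some \<open>y\<close> satisfies \<open>\<kappa>'(y, {x}) = 1\<close>, that is, \<open>\<kappa>'(y, \<cdot>)\<close> is the Dirac
  measure at \<open>x\<close>. Composing the other way round gives \<open>\<kappa>(x, \<cdot>) = (\<kappa> \<circ> \<kappa>')(y, \<cdot>) = \<delta>\<^sub>y\<close>. So every \<open>\<kappa>(x, \<cdot>)\<close>
  is a Dirac measure (lemma \<open>inverse_kernels_dirac\<close>), hence \<open>\<kappa>\<close> comes from a map \<open>f\<close>, and by
  symmetry \<open>\<kappa>'\<close> comes from a map \<open>g\<close>. As measurable singletons make points distinguishable by
  their Dirac measures, \<open>g\<close> is inverse to \<open>f\<close>. The conditions on the measures translate back through the
  dictionary.
\<close>

section \<open>Dirac measures\<close>

lemma return_eq_iff: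
  assumes "x \<in> space X" "{x} \<in> sets X"
  shows "return X x = return X y \<longleftrightarrow> x = y"
proof
  assume "return X x = return X y"
  then have "emeasure (return X x) {x} = emeasure (return X y) {x}"
    by simp
  then show "x = y"
    using assms by (simp add: indicator_def split: if_splits)
qed simp

lemma prob_measure_eq_return:
  assumes M: "sets M = sets X" "prob_space M"
    and x: "{x} \<in> sets X" "emeasure M {x} = 1"
  shows "M = return X x"
proof (rule measure_eqI)
  interpret prob_space M by fact
  fix A assume A: "A \<in> sets M"
  \<comment> \<open>Almost every point is \<open>x\<close>, so \<open>A\<close> is almost everything or almost nothing.\<close>
  have "AE y in M. y \<in> {x}"
    using x by (intro AE_prob_1) (simp add: measure_def)
  then have "AE y in M. (y \<in> A) = (x \<in> A)"
    by eventually_elim auto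
  then have "emeasure M A = emeasure M (if x \<in> A then space M else {})"
    using A by (intro emeasure_eq_AE) auto
  then show "emeasure M A = emeasure (return X x) A"
    using A M emeasure_space_1 by (simp add: indicator_def)
qed (use M in simp)

lemma return_pair_measure:
  assumes "a \<in> space Y" "b \<in> space Z"
  shows "return Y a \<Otimes>\<^sub>M return Z b = return (Y \<Otimes>\<^sub>M Z) (a, b)"
proof (rule measure_eqI)
  interpret b: prob_space "return Z b"
    using assms by (intro prob_space_return)
  fix A assume "A \<in> sets (return Y a \<Otimes>\<^sub>M return Z b)"
  moreover have eq: "sets (return Y a \<Otimes>\<^sub>M return Z b) = sets (Y \<Otimes>\<^sub>M Z)"
    by (intro sets_pair_measure_cong) simp_all
  ultimately have [measurable]: "A \<in> sets (Y \<Otimes>\<^sub>M Z)" by simp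
  have "emeasure (return Y a \<Otimes>\<^sub>M return Z b) A
      = (\<integral>\<^sup>+ y. \<integral>\<^sup>+ z. indicator A (y, z) \<partial>return Z b \<partial>return Y a)"
    by (intro b.emeasure_pair_measure) (simp add: eq)
  also have "\<dots> = (\<integral>\<^sup>+ y. indicator A (y, b) \<partial>return Y a)"
    using assms by (intro nn_integral_cong nn_integral_return) auto
  also have "\<dots> = indicator A (a, b)"
    using assms by (intro nn_integral_return) auto
  finally show "emeasure (return Y a \<Otimes>\<^sub>M return Z b) A = emeasure (return (Y \<Otimes>\<^sub>M Z) (a, b)) A"
    by simp
next
  show "sets (return Y a \<Otimes>\<^sub>M return Z b) = sets (return (Y \<Otimes>\<^sub>M Z) (a, b))"
    unfolding sets_return by (intro sets_pair_measure_cong) simp_all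
qed

section \<open>Kernels induced by maps\<close>

lemma kernel_of_markov:
  assumes [measurable]: "f \<in> X \<rightarrow>\<^sub>M Y"
  shows "kernel_of X Y f \<in> markov_kernels X Y"
proof -
  have "(\<lambda>x. emeasure (kernel_of X Y f x) B) \<in> borel_measurable X" if [measurable]: "B \<in> sets Y" for B
  proof -
    have "(\<lambda>x. indicator B (f x) :: ennreal) \<in> borel_measurable X" by measurable
    then show ?thesis
      by (rule measurable_cong[THEN iffD1, rotated])
        (use that in \<open>simp add: emeasure_kernel_of indicator_def\<close>)
  qed
  then show ?thesis
    using measurable_space[OF assms]
    by (auto simp: markov_kernels_iff kernel_of_def prob_space_return)
qed

lemma kernel_push_kernel_of:
  assumes f: "f \<in> X \<rightarrow>\<^sub>M Y" and \<nu>: "sets \<nu> = sets X" and ne: "space X \<noteq> {}"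
  shows "kernel_push (kernel_of X Y f) \<nu> = distr \<nu> Y f"
proof -
  have sp: "space \<nu> = space X" using sets_eq_imp_space_eq[OF \<nu>] .
  have f': "f \<in> \<nu> \<rightarrow>\<^sub>M Y" using f \<nu> by (simp cong: measurable_cong_sets)
  have "Giry_Monad.bind \<nu> (kernel_of X Y f) = Giry_Monad.bind \<nu> (return Y \<circ> f)"
    by (intro bind_cong) (simp_all add: kernel_of_def sp)
  also have "\<dots> = distr \<nu> Y f"
    using f' ne sp by (intro bind_return_distr) auto
  finally show ?thesis by (simp add: kernel_push_def)
qed

lemma kernel_square_kernel_of:
  assumes f: "f \<in> X \<rightarrow>\<^sub>M Y"
  shows "kernel_square X (kernel_of X Y f) = kernel_of (X \<Otimes>\<^sub>M X) (Y \<Otimes>\<^sub>M Y) (map_prod f f)"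
  using measurable_space[OF f]
  by (auto simp: fun_eq_iff kernel_square_def kernel_of_def space_pair_measure return_pair_measure
      restrict_def)

lemma kernel_comp_dirac:
  assumes k': "\<kappa>' \<in> markov_kernels Y Z" and x: "x \<in> space X" and y: "y \<in> space Y"
    and \<kappa>: "\<kappa> x = return Y y"
  shows "kernel_comp X \<kappa>' \<kappa> x = \<kappa>' y"
proof -
  have "\<kappa>' \<in> Y \<rightarrow>\<^sub>M subprob_algebra Z"
    using k' by (auto simp: markov_kernels_def measurable_prob_algebraD)
  from bind_return[OF this y] show ?thesis
    using x by (simp add: kernel_comp_def \<kappa>)
qed

lemma kernel_comp_kernel_of:
  assumes f: "f \<in> X \<rightarrow>\<^sub>M Y" and g: "g \<in> Y \<rightarrow>\<^sub>M Z"
  shows "kernel_comp X (kernel_of Y Z g) (kernel_of X Y f) = kernel_of X Z (\<lambda>x. g (f x))"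
proof
  fix x
  show "kernel_comp X (kernel_of Y Z g) (kernel_of X Y f) x = kernel_of X Z (\<lambda>x. g (f x)) x"
  proof (cases "x \<in> space X")
    case True
    then show ?thesis
      using kernel_comp_dirac[OF kernel_of_markov[OF g] True measurable_space[OF f True],
          of "kernel_of X Y f"] measurable_space[OF f True]
      by (simp add: kernel_of_def)
  qed (simp add: kernel_comp_def kernel_of_def)
qed

lemma measurable_map_prod:
  assumes [measurable]: "f \<in> X \<rightarrow>\<^sub>M Y"
  shows "map_prod f f \<in> X \<Otimes>\<^sub>M X \<rightarrow>\<^sub>M Y \<Otimes>\<^sub>M Y"
  unfolding map_prod_def by measurable

lemma kernel_of_graphon_hom_iff:
  assumes G: "box_graphon X (\<pi>X, \<mu>X)" and f: "f \<in> X \<rightarrow>\<^sub>M Y"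
  shows "kernel_of X Y f \<in> graphon_hom X (\<pi>X, \<mu>X) Y (\<pi>Y, \<mu>Y) \<longleftrightarrow>
    distr \<pi>X Y f = \<pi>Y \<and> distr \<mu>X (Y \<Otimes>\<^sub>M Y) (map_prod f f) = \<mu>Y"
proof -
  have \<pi>: "sets \<pi>X = sets X" "prob_space \<pi>X" and \<mu>: "sets \<mu>X = sets (X \<Otimes>\<^sub>M X)"
    using G by (auto simp: box_graphon_def)
  \<comment> \<open>On an empty space the monadic bind has a default value instead of the pushforward.\<close>
  have ne: "space X \<noteq> {}"
    using prob_space.not_empty[OF \<pi>(2)] sets_eq_imp_space_eq[OF \<pi>(1)] by simp
  then have ne2: "space (X \<Otimes>\<^sub>M X) \<noteq> {}"
    by (simp add: space_pair_measure)
  show ?thesis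
    using kernel_push_kernel_of[OF f \<pi>(1) ne]
      kernel_push_kernel_of[OF measurable_map_prod[OF f] \<mu> ne2]
    by (simp add: graphon_hom_def kernel_of_markov[OF f] kernel_square_kernel_of[OF f])
qed

lemma distr_distr_left_inverse:
  assumes f: "f \<in> X \<rightarrow>\<^sub>M Y" and g: "g \<in> Y \<rightarrow>\<^sub>M X" and gf: "\<And>x. x \<in> space X \<Longrightarrow> g (f x) = x"
    and M: "sets M = sets X"
  shows "distr (distr M Y f) X g = M"
proof -
  have f': "f \<in> M \<rightarrow>\<^sub>M Y" using f M by (simp cong: measurable_cong_sets)
  have "distr (distr M Y f) X g = distr M X (g \<circ> f)"
    by (rule distr_distr[OF g f'])
  also have "\<dots> = distr M M (\<lambda>x. x)"
    using M gf by (intro distr_cong) (auto dest: sets_eq_imp_space_eq)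
  finally show ?thesis by (simp add: distr_id)
qed

section \<open>Isomorphisms of measurable spaces give isomorphisms\<close>

lemma kernel_of_graphon_iso:
  assumes G: "box_graphon X (\<pi>X, \<mu>X)" and H: "box_graphon Y (\<pi>Y, \<mu>Y)"
    and f_iso: "f \<in> measurable_iso X Y"
    and push: "distr \<pi>X Y f = \<pi>Y" "distr \<mu>X (Y \<Otimes>\<^sub>M Y) (map_prod f f) = \<mu>Y"
  shows "kernel_of X Y f \<in> graphon_iso X (\<pi>X, \<mu>X) Y (\<pi>Y, \<mu>Y)"
proof -
  define g where "g = inv_into (space X) f"
  have f: "f \<in> X \<rightarrow>\<^sub>M Y" and g: "g \<in> Y \<rightarrow>\<^sub>M X" and bij: "bij_betw f (space X) (space Y)"
    using f_iso by (auto simp: measurable_iso_def g_def)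
  have gf: "g (f x) = x" if "x \<in> space X" for x
    unfolding g_def using bij that by (rule bij_betw_inv_into_left)
  have fg: "f (g y) = y" if "y \<in> space Y" for y
    unfolding g_def using bij that by (rule bij_betw_inv_into_right)
  have "distr \<pi>Y X g = \<pi>X"
    using distr_distr_left_inverse[OF f g gf, of \<pi>X] G push by (simp add: box_graphon_def)
  moreover have "distr \<mu>Y (X \<Otimes>\<^sub>M X) (map_prod g g) = \<mu>X"
    using distr_distr_left_inverse[OF measurable_map_prod[OF f] measurable_map_prod[OF g], of \<mu>X]
      gf G push
    by (auto simp: box_graphon_def space_pair_measure)
  ultimately have "kernel_of Y X g \<in> graphon_hom Y (\<pi>Y, \<mu>Y) X (\<pi>X, \<mu>X)"
    by (simp add: kernel_of_graphon_hom_iff[OF H g])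
  moreover have "kernel_of X Y f \<in> graphon_hom X (\<pi>X, \<mu>X) Y (\<pi>Y, \<mu>Y)"
    by (simp add: kernel_of_graphon_hom_iff[OF G f] push)
  moreover have "kernel_comp X (kernel_of Y X g) (kernel_of X Y f) = kernel_of X X (\<lambda>x. x)"
    unfolding kernel_comp_kernel_of[OF f g] by (simp add: kernel_of_def gf cong: restrict_cong)
  moreover have "kernel_comp Y (kernel_of X Y f) (kernel_of Y X g) = kernel_of Y Y (\<lambda>y. y)"
    unfolding kernel_comp_kernel_of[OF g f] by (simp add: kernel_of_def fg cong: restrict_cong)
  ultimately show ?thesis
    unfolding graphon_iso_def by blast
qed

section \<open>Invertible kernels come from maps\<close>

text \<open>
  A probability average of numbers in \<open>[0, 1]\<close> can be 1 only if almost all of them are 1; so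
  from \<open>(\<kappa>' \<circ> \<kappa>)(x, {x}) = 1\<close> there is a point \<open>y\<close> with \<open>\<kappa>'(y, {x}) = 1\<close>.
\<close>
lemma kernel_left_inverse_dirac:
  assumes k: "\<kappa> \<in> markov_kernels X Y" and k': "\<kappa>' \<in> markov_kernels Y X"
    and comp: "kernel_comp X \<kappa>' \<kappa> = kernel_of X X (\<lambda>x. x)"
    and x: "x \<in> space X" "{x} \<in> sets X"
  obtains y where "y \<in> space Y" "\<kappa>' y = return X x"
proof -
  have sets: "sets (\<kappa> x) = sets Y" and "prob_space (\<kappa> x)"
    using k x by (auto simp: markov_kernels_iff)
  interpret prob_space "\<kappa> x" by fact
  have sp: "space (\<kappa> x) = space Y" using sets_eq_imp_space_eq[OF sets] .
  have p': "sets (\<kappa>' y) = sets X" "prob_space (\<kappa>' y)" if "y \<in> space Y" for y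
    using k' that by (auto simp: markov_kernels_iff)
  have meas: "(\<lambda>y. emeasure (\<kappa>' y) {x}) \<in> borel_measurable (\<kappa> x)"
    using k' x sets by (simp add: markov_kernels_iff cong: measurable_cong_sets)
  have le: "emeasure (\<kappa>' y) {x} \<le> 1" if "y \<in> space Y" for y
    by (meson p'(2)[OF that] prob_space.measure_le_1)
  have int: "(\<integral>\<^sup>+ y. emeasure (\<kappa>' y) {x} \<partial>\<kappa> x) = 1"
    using emeasure_kernel_comp[OF k k' x] emeasure_kernel_of[OF x, of "\<lambda>x. x"] by (simp add: comp)
  have "\<exists>y\<in>space Y. emeasure (\<kappa>' y) {x} = 1"
  proof (rule ccontr)
    assume "\<not> ?thesis"
    then have lt: "emeasure (\<kappa>' y) {x} < 1" if "y \<in> space Y" for y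
      using le[OF that] that by (auto simp: less_le)
    have "(\<integral>\<^sup>+ y. emeasure (\<kappa>' y) {x} \<partial>\<kappa> x) < (\<integral>\<^sup>+ y. 1 \<partial>\<kappa> x)"
    proof (rule nn_integral_less)
      show "\<not> (AE y in \<kappa> x. 1 \<le> emeasure (\<kappa>' y) {x})"
      proof
        assume "AE y in \<kappa> x. 1 \<le> emeasure (\<kappa>' y) {x}"
        then have "AE y in \<kappa> x. False"
          using AE_space by eventually_elim (use lt sp in force)
        then show False by simp
      qed
    qed (use meas int lt sp in \<open>auto intro!: AE_I2 less_imp_le\<close>)
    then show False
      by (simp add: int emeasure_space_1)
  qed
  then obtain y where y: "y \<in> space Y" "emeasure (\<kappa>' y) {x} = 1" by blast
  then show thesis
    using that prob_measure_eq_return[OF p'[OF y(1)] x(2) y(2)] by blast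
qed

text \<open>
  If \<open>\<kappa>'(y, \<cdot>)\<close> is the Dirac measure at \<open>x\<close>, then averaging \<open>\<kappa>\<close> over it returns \<open>\<kappa>(x, \<cdot>)\<close>, while
  \<open>\<kappa> \<circ> \<kappa>' = id\<close> says that this average is the Dirac measure at \<open>y\<close>.
\<close>
lemma inverse_kernels_dirac:
  assumes k: "\<kappa> \<in> markov_kernels X Y" and k': "\<kappa>' \<in> markov_kernels Y X"
    and comp: "kernel_comp X \<kappa>' \<kappa> = kernel_of X X (\<lambda>x. x)"
    and comp': "kernel_comp Y \<kappa> \<kappa>' = kernel_of Y Y (\<lambda>y. y)"
    and x: "x \<in> space X" "{x} \<in> sets X"
  shows "\<exists>y\<in>space Y. \<kappa> x = return Y y \<and> \<kappa>' y = return X x"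
proof -
  obtain y where y: "y \<in> space Y" "\<kappa>' y = return X x"
    using kernel_left_inverse_dirac[OF k k' comp x] .
  have "\<kappa> x = kernel_comp Y \<kappa> \<kappa>' y"
    using kernel_comp_dirac[where X=Y and \<kappa>=\<kappa>', OF k y(1) x(1) y(2)] by simp
  also have "\<dots> = return Y y"
    using y by (simp add: comp' kernel_of_def)
  finally show ?thesis using y by blast
qed

text \<open>
  The map behind a Dirac-valued kernel is measurable because \<open>f x \<in> B\<close> is the condition
  \<open>\<kappa>(x, B) = 1\<close> on \<open>x\<close>.
\<close>
lemma dirac_kernel_measurable:
  assumes k: "\<kappa> \<in> markov_kernels X Y"
    and f: "\<And>x. x \<in> space X \<Longrightarrow> f x \<in> space Y \<and> \<kappa> x = return Y (f x)"
  shows "f \<in> X \<rightarrow>\<^sub>M Y"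
proof (rule measurableI)
  fix B assume B: "B \<in> sets Y"
  have [measurable]: "(\<lambda>x. emeasure (\<kappa> x) B) \<in> borel_measurable X"
    using k B by (simp add: markov_kernels_iff)
  have "f -` B \<inter> space X = {x \<in> space X. emeasure (\<kappa> x) B = 1}"
    using f B by (auto simp: indicator_def split: if_splits)
  also have "\<dots> \<in> sets X" by measurable
  finally show "f -` B \<inter> space X \<in> sets X" .
qed (use f in blast)

lemma dirac_kernel_eq_kernel_of:
  assumes "\<kappa> \<in> markov_kernels X Y" "\<And>x. x \<in> space X \<Longrightarrow> \<kappa> x = return Y (f x)"
  shows "\<kappa> = kernel_of X Y f"
  using assms by (intro extensionalityI[of _ "space X"]) (auto simp: markov_kernels_def kernel_of_def)

lemma inverse_kernels_from_measurable_iso: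
  assumes k: "\<kappa> \<in> markov_kernels X Y" and k': "\<kappa>' \<in> markov_kernels Y X"
    and comp: "kernel_comp X \<kappa>' \<kappa> = kernel_of X X (\<lambda>x. x)"
    and comp': "kernel_comp Y \<kappa> \<kappa>' = kernel_of Y Y (\<lambda>y. y)"
    and X: "\<And>x. x \<in> space X \<Longrightarrow> {x} \<in> sets X" and Y: "\<And>y. y \<in> space Y \<Longrightarrow> {y} \<in> sets Y"
  shows "\<exists>f\<in>measurable_iso X Y. \<kappa> = kernel_of X Y f"
proof -
  obtain f where f: "\<And>x. x \<in> space X \<Longrightarrow> f x \<in> space Y \<and> \<kappa> x = return Y (f x) \<and> \<kappa>' (f x) = return X x"
    using inverse_kernels_dirac[OF k k' comp comp'] X by metis
  obtain g where g: "\<And>y. y \<in> space Y \<Longrightarrow> g y \<in> space X \<and> \<kappa>' y = return X (g y) \<and> \<kappa> (g y) = return Y y"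
    using inverse_kernels_dirac[OF k' k comp' comp] Y by metis
  have fm: "f \<in> X \<rightarrow>\<^sub>M Y" using f by (intro dirac_kernel_measurable[OF k]) blast
  have gm: "g \<in> Y \<rightarrow>\<^sub>M X" using g by (intro dirac_kernel_measurable[OF k']) blast
  have gf: "g (f x) = x" if x: "x \<in> space X" for x
    using f[OF x] g[of "f x"] return_eq_iff[OF x X[OF x]] by metis
  have fg: "f (g y) = y" if y: "y \<in> space Y" for y
    using g[OF y] f[of "g y"] return_eq_iff[OF y Y[OF y]] by metis
  have bij: "bij_betw f (space X) (space Y)"
    using f g gf fg by (intro bij_betw_byWitness[where f'=g]) auto
  have inv: "inv_into (space X) f y = g y" if y: "y \<in> space Y" for y
    using bij_betw_inv_into_left[OF bij, of "g y"] fg[OF y] g[OF y] by simp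
  have "inv_into (space X) f \<in> Y \<rightarrow>\<^sub>M X"
    using gm inv by (simp cong: measurable_cong)
  then have "f \<in> measurable_iso X Y"
    using fm bij by (simp add: measurable_iso_def)
  then show ?thesis
    using dirac_kernel_eq_kernel_of[OF k, of f] f by blast
qed

section \<open>The isomorphisms of the category of box-graphons\<close>

theorem proposition6p1:
  fixes X :: "'a measure" and \<pi>X :: "'a measure" and \<mu>X :: "('a \<times> 'a) measure"
    and Y :: "'b measure" and \<pi>Y :: "'b measure" and \<mu>Y :: "('b \<times> 'b) measure"
  assumes "box_graphon X (\<pi>X, \<mu>X)" and "box_graphon Y (\<pi>Y, \<mu>Y)"
  shows "(\<forall>f \<in> measurable_iso X Y.
            distr \<pi>X Y f = \<pi>Y \<and> distr \<mu>X (Y \<Otimes>\<^sub>M Y) (map_prod f f) = \<mu>Y \<longrightarrow>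
            kernel_of X Y f \<in> graphon_iso X (\<pi>X, \<mu>X) Y (\<pi>Y, \<mu>Y)) \<and>
         ((\<forall>x \<in> space X. {x} \<in> sets X) \<and> (\<forall>y \<in> space Y. {y} \<in> sets Y) \<longrightarrow>
          (\<forall>\<kappa> \<in> graphon_iso X (\<pi>X, \<mu>X) Y (\<pi>Y, \<mu>Y).
             \<exists>f \<in> measurable_iso X Y.
               distr \<pi>X Y f = \<pi>Y \<and> distr \<mu>X (Y \<Otimes>\<^sub>M Y) (map_prod f f) = \<mu>Y \<and>
               \<kappa> = kernel_of X Y f))"
proof (intro conjI impI ballI)
  fix f assume "f \<in> measurable_iso X Y"
    "distr \<pi>X Y f = \<pi>Y \<and> distr \<mu>X (Y \<Otimes>\<^sub>M Y) (map_prod f f) = \<mu>Y"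
  then show "kernel_of X Y f \<in> graphon_iso X (\<pi>X, \<mu>X) Y (\<pi>Y, \<mu>Y)"
    using kernel_of_graphon_iso[OF assms] by blast
next
  fix \<kappa>
  assume single: "(\<forall>x \<in> space X. {x} \<in> sets X) \<and> (\<forall>y \<in> space Y. {y} \<in> sets Y)"
    and \<kappa>: "\<kappa> \<in> graphon_iso X (\<pi>X, \<mu>X) Y (\<pi>Y, \<mu>Y)"
  from \<kappa> obtain \<kappa>' where hom: "\<kappa> \<in> graphon_hom X (\<pi>X, \<mu>X) Y (\<pi>Y, \<mu>Y)"
    and hom': "\<kappa>' \<in> graphon_hom Y (\<pi>Y, \<mu>Y) X (\<pi>X, \<mu>X)"
    and comp: "kernel_comp X \<kappa>' \<kappa> = kernel_of X X (\<lambda>x. x)"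
      "kernel_comp Y \<kappa> \<kappa>' = kernel_of Y Y (\<lambda>y. y)"
    unfolding graphon_iso_def by blast
  have "\<kappa> \<in> markov_kernels X Y" "\<kappa>' \<in> markov_kernels Y X"
    using hom hom' by (auto simp: graphon_hom_def)
  from inverse_kernels_from_measurable_iso[OF this comp] single
  obtain f where f: "f \<in> measurable_iso X Y" "\<kappa> = kernel_of X Y f"
    by blast
  then have "f \<in> X \<rightarrow>\<^sub>M Y" by (simp add: measurable_iso_def)
  with f hom show "\<exists>f \<in> measurable_iso X Y.
      distr \<pi>X Y f = \<pi>Y \<and> distr \<mu>X (Y \<Otimes>\<^sub>M Y) (map_prod f f) = \<mu>Y \<and> \<kappa> = kernel_of X Y f"
    using kernel_of_graphon_hom_iff[OF assms(1)] by blast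
qed

end
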